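(* Let $G$ be a sequenceable finite group of order $n$ and let $k\ge 2$ be an integer. Then there exists a sequence ${\bf p}: p_0,\ldots,p_{kn-1}$ in $G$ with $p_0=1_G$ such that every element of $G$ appears exactly $k$ times in each of ${\bf p}$ and ${\bf \bar p}$. Moreover, when $k=2$, one can choose ${\bf p}$ to be a cyclic D-sequence.
   Context: All groups are finite; $1_G$ denotes the identity of a group $G$. For a sequence ${\bf g}: g_0,\ldots,g_m$ in a group $G$ with $g_0=1_G$, the sequence of consecutive quotients ${\bf \bar g}:\bar g_0,\ldots,\bar g_m$ is defined by $\bar g_0=1_G$ and $\bar g_i=g_{i-1}^{-1}g_i$ for $1\le i\le m$. A finite group $G$ of order $n$ is sequenceable if there is a sequence ${\bf g}: g_0,\ldots,g_{n-1}$ in $G$ with $g_0=1_G$ such that every element of $G$ appears exactly once in each of ${\bf g}$ and ${\bf \bar g}$. A D-sequence in a finite group $G$ of order $n$ is a sequence ${\bf g}: g_0,\ldots,g_{2n-1}$ in $G$ with $g_0=1_G$ such that every element of $G$ appears exactly twice in each of ${\bf g}$ and ${\bf \bar g}$. A D-sequence is cyclic if $g_{2n-1}=1_G$. *)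

theory Defs
  imports "HOL-Algebra.Group" "HOL-Algebra.Coset"
begin

text \<open>
  A sequence \<open>g\<^sub>0, \<dots>, g\<^sub>m\<close> is the list of length \<open>m + 1\<close> whose entry at index \<open>i\<close> is \<open>g\<^sub>i\<close>.
\<close>

definition consecutive_quotients :: "('a, 'b) monoid_scheme \<Rightarrow> 'a list \<Rightarrow> 'a list" where
  "consecutive_quotients G g =
     map (\<lambda>i. if i = 0 then \<one>\<^bsub>G\<^esub> else inv\<^bsub>G\<^esub> (g ! (i - 1)) \<otimes>\<^bsub>G\<^esub> g ! i) [0..<length g]"

text \<open>
  The predicates below are meant for finite groups only; finiteness matters since
  \<open>order\<close> is \<open>0\<close> on infinite carriers.
\<close>

definition k_fold_sequence :: "('a, 'b) monoid_scheme \<Rightarrow> nat \<Rightarrow> 'a list \<Rightarrow> bool" where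
  "k_fold_sequence G k g \<longleftrightarrow>
     set g \<subseteq> carrier G \<and> length g = k * order G \<and> g ! 0 = \<one>\<^bsub>G\<^esub> \<and>
     (\<forall>x \<in> carrier G. count_list g x = k \<and> count_list (consecutive_quotients G g) x = k)"

definition sequenceable :: "('a, 'b) monoid_scheme \<Rightarrow> bool" where
  "sequenceable G \<longleftrightarrow> (\<exists>g. k_fold_sequence G 1 g)"

definition D_sequence :: "('a, 'b) monoid_scheme \<Rightarrow> 'a list \<Rightarrow> bool" where
  "D_sequence G g \<longleftrightarrow> k_fold_sequence G 2 g"

definition cyclic_D_sequence :: "('a, 'b) monoid_scheme \<Rightarrow> 'a list \<Rightarrow> bool" where
  "cyclic_D_sequence G g \<longleftrightarrow> D_sequence G g \<and> g ! (2 * order G - 1) = \<one>\<^bsub>G\<^esub>"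

end

theory Submission
  imports Defs
begin

text \<open>
  Walk through the given sequence \<open>g\<close> alternately forwards and backwards, \<open>k\<close> times in all.  Each
  pass visits every element of \<open>G\<close> once.  A pass starts at the element where the previous pass
  stopped, so the quotient at the junction is the identity, which is exactly the initial entry that
  the next pass has by convention when it is regarded as a sequence of its own.  Hence the
  quotients of the whole walk are the concatenated quotients of its passes
  (\<open>consecutive_quotients_append\<close>).  Reversing a sequence inverts its
  quotients, and inversion permutes \<open>G\<close>, so a backward pass also has every element exactly once
  among its quotients (\<open>count_consecutive_quotients_rev\<close>).  For \<open>k = 2\<close> the walk is \<open>g\<close> followed by
  its reversal and therefore ends where it started, at the identity.
\<close>

lemma length_consecutive_quotients [simp]: "length (consecutive_quotients G g) = length g"
  by (simp add: consecutive_quotients_def)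

lemma nth_consecutive_quotients:
  assumes "i < length g"
  shows "consecutive_quotients G g ! i =
    (if i = 0 then \<one>\<^bsub>G\<^esub> else inv\<^bsub>G\<^esub> (g ! (i - 1)) \<otimes>\<^bsub>G\<^esub> g ! i)"
  using assms by (simp add: consecutive_quotients_def)

lemma (in group) consecutive_quotients_closed:
  assumes "set g \<subseteq> carrier G"
  shows "set (consecutive_quotients G g) \<subseteq> carrier G"
proof -
  have "g ! i \<in> carrier G" if "i < length g" for i
    using assms that nth_mem by blast
  then show ?thesis
    by (auto simp: consecutive_quotients_def)
qed

text \<open>
  Sharing the junction element is what makes the quotients concatenate: the entry at the junction
  is \<open>x\<^sup>-\<^sup>1 x = \<one>\<close>, the same as the conventional first entry of the quotients of \<open>ys\<close>.
\<close>

lemma (in group) consecutive_quotients_append: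
  assumes "set xs \<subseteq> carrier G" and "xs \<noteq> []" and "ys \<noteq> []" and "last xs = hd ys"
  shows "consecutive_quotients G (xs @ ys) =
    consecutive_quotients G xs @ consecutive_quotients G ys"
proof (rule nth_equalityI)
  fix i
  assume "i < length (consecutive_quotients G (xs @ ys))"
  then have i: "i < length xs + length ys" by simp
  have "last xs \<in> carrier G" using assms(1,2) by auto
  then have junction: "inv (xs ! (length xs - 1)) \<otimes> ys ! 0 = \<one>"
    using assms by (simp add: last_conv_nth hd_conv_nth)
  consider "i < length xs" | "i = length xs" | j where "i = length xs + Suc j"
    by (metis less_imp_Suc_add linorder_neqE_nat add_Suc_right)
  then show "consecutive_quotients G (xs @ ys) ! i =
    (consecutive_quotients G xs @ consecutive_quotients G ys) ! i"
  proof cases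
    case 1
    then have "i - 1 < length xs" by simp
    with 1 show ?thesis by (simp add: nth_consecutive_quotients nth_append)
  next
    case 2
    then show ?thesis
      using assms(2,3) junction by (simp add: nth_consecutive_quotients nth_append)
  next
    case 3
    then show ?thesis using i by (simp add: nth_consecutive_quotients nth_append)
  qed
qed simp

text \<open>
  A backward step from \<open>y\<close> to \<open>x\<close> has quotient \<open>y\<^sup>-\<^sup>1 x = (x\<^sup>-\<^sup>1 y)\<^sup>-\<^sup>1\<close>.  The initial \<open>\<one>\<close> belongs
  to no step, so it stays in front.
\<close>

lemma (in group) consecutive_quotients_rev:
  assumes "set g \<subseteq> carrier G" and "g \<noteq> []"
  shows "consecutive_quotients G (rev g) =
    \<one> # rev (map (\<lambda>x. inv x) (tl (consecutive_quotients G g)))"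
proof (rule nth_equalityI)
  show "length (consecutive_quotients G (rev g)) =
    length (\<one> # rev (map (\<lambda>x. inv x) (tl (consecutive_quotients G g))))"
    using assms(2) by simp
next
  fix i
  assume "i < length (consecutive_quotients G (rev g))"
  then have i: "i < length g" by simp
  have mem: "g ! j \<in> carrier G" if "j < length g" for j
    using assms(1) that nth_mem by blast
  show "consecutive_quotients G (rev g) ! i =
    (\<one> # rev (map (\<lambda>x. inv x) (tl (consecutive_quotients G g)))) ! i"
  proof (cases i)
    case 0
    then show ?thesis using i by (simp add: nth_consecutive_quotients)
  next
    case (Suc j)
    define m where "m = length g - Suc (Suc j)"
    have m: "Suc m < length g" "length g - Suc j = Suc m" "length g - Suc i = m"
      using Suc i by (auto simp: m_def)
    have "inv (g ! Suc m) \<otimes> g ! m = inv (inv (g ! m) \<otimes> g ! Suc m)"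
      using m(1) mem by (simp add: inv_mult_group)
    then show ?thesis
      using Suc i m by (simp add: nth_consecutive_quotients rev_nth nth_tl m_def)
  qed
qed

lemma (in group) count_list_map_inv:
  assumes "set xs \<subseteq> carrier G" and "x \<in> carrier G"
  shows "count_list (map (\<lambda>y. inv y) xs) x = count_list xs (inv x)"
  using assms by (induction xs) auto

lemma (in group) count_consecutive_quotients_rev:
  assumes "set g \<subseteq> carrier G" and "x \<in> carrier G"
  shows "count_list (consecutive_quotients G (rev g)) x =
    count_list (consecutive_quotients G g) (inv x)"
proof (cases "g = []")
  case True
  then show ?thesis by (simp add: consecutive_quotients_def)
next
  case False
  let ?q = "consecutive_quotients G g"
  have "?q ! 0 = \<one>" using False by (simp add: nth_consecutive_quotients)
  moreover have "?q \<noteq> []" using False length_consecutive_quotients[of G g] by force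
  ultimately have q: "?q = \<one> # tl ?q" by (metis hd_conv_nth list.collapse)
  have "set (tl ?q) \<subseteq> carrier G"
    using consecutive_quotients_closed[OF assms(1)] q by (metis set_subset_Cons subset_trans)
  then have "count_list (map (\<lambda>y. inv y) (tl ?q)) x = count_list (tl ?q) (inv x)"
    using assms(2) by (rule count_list_map_inv)
  moreover have "\<one> = x \<longleftrightarrow> \<one> = inv x" using assms(2) by (metis inv_inv inv_one)
  ultimately show ?thesis
    using consecutive_quotients_rev[OF assms(1) False]
    by (subst q) simp
qed

primrec zigzag :: "'a list \<Rightarrow> nat \<Rightarrow> 'a list" where
  "zigzag g 0 = []"
| "zigzag g (Suc k) = zigzag g k @ (if even k then g else rev g)"

lemma set_zigzag: "set (zigzag g k) \<subseteq> set g"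
  by (induction k) auto

lemma length_zigzag: "length (zigzag g k) = k * length g"
  by (induction k) auto

lemma count_zigzag: "count_list (zigzag g k) x = k * count_list g x"
  by (induction k) auto

lemma hd_zigzag:
  assumes "g \<noteq> []" and "k > 0"
  shows "hd (zigzag g k) = hd g"
  using assms(2)
proof (induction k)
  case (Suc k)
  have "zigzag g k \<noteq> []" if "k > 0"
    using that assms(1) length_zigzag[of g k] by force
  then show ?case using Suc by (cases "k = 0") auto
qed simp

lemma last_zigzag:
  assumes "g \<noteq> []" and "k > 0"
  shows "last (zigzag g k) = (if even k then hd g else last g)"
  using assms by (cases k) (auto simp: last_rev)

text \<open>
  A backward pass counts \<open>inv x\<close> where a forward pass counts \<open>x\<close>, hence the invariance assumption;
  in the application both counts are \<open>1\<close>.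
\<close>

lemma (in group) count_consecutive_quotients_zigzag:
  assumes "set g \<subseteq> carrier G" and "g \<noteq> []" and "x \<in> carrier G"
    and inv_invariant: "count_list (consecutive_quotients G g) (inv x) =
      count_list (consecutive_quotients G g) x"
  shows "count_list (consecutive_quotients G (zigzag g k)) x =
    k * count_list (consecutive_quotients G g) x"
proof (induction k)
  case 0
  then show ?case by (simp add: consecutive_quotients_def)
next
  case (Suc k)
  let ?pass = "if even k then g else rev g"
  have pass: "count_list (consecutive_quotients G ?pass) x =
      count_list (consecutive_quotients G g) x"
    using assms count_consecutive_quotients_rev by simp
  show ?case
  proof (cases "k = 0")
    case True
    then show ?thesis by simp
  next
    case False
    have "consecutive_quotients G (zigzag g k @ ?pass) =
        consecutive_quotients G (zigzag g k) @ consecutive_quotients G ?pass"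
    proof (rule consecutive_quotients_append)
      show "set (zigzag g k) \<subseteq> carrier G" using set_zigzag assms(1) by (rule subset_trans)
      show "zigzag g k \<noteq> []" using False assms(2) length_zigzag[of g k] by force
      show "?pass \<noteq> []" using assms(2) by simp
      show "last (zigzag g k) = hd ?pass"
        using False assms(2) by (simp add: last_zigzag hd_rev)
    qed
    then show ?thesis using Suc pass by simp
  qed
qed

theorem lemma5:
  fixes G :: "('a, 'b) monoid_scheme" and k :: nat
  assumes "group G" and "finite (carrier G)" and "sequenceable G" and "k \<ge> 2"
  shows "\<exists>p. k_fold_sequence G k p \<and> (k = 2 \<longrightarrow> cyclic_D_sequence G p)"
proof -
  interpret group G by fact
  obtain g where g: "k_fold_sequence G 1 g"
    using assms(3) by (auto simp: sequenceable_def)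
  have carrier: "set g \<subseteq> carrier G" and len: "length g = order G" and start: "g ! 0 = \<one>\<^bsub>G\<^esub>"
    and count: "\<And>x. x \<in> carrier G \<Longrightarrow> count_list g x = 1"
    and count_q: "\<And>x. x \<in> carrier G \<Longrightarrow> count_list (consecutive_quotients G g) x = 1"
    using g by (auto simp: k_fold_sequence_def)
  have nonempty: "g \<noteq> []" using len order_gt_0_iff_finite assms(2) by force
  let ?p = "zigzag g k"
  have p_nonempty: "?p \<noteq> []" using nonempty assms(4) length_zigzag[of g k] by force
  have p: "k_fold_sequence G k ?p"
    unfolding k_fold_sequence_def
  proof (intro conjI ballI)
    show "set ?p \<subseteq> carrier G" using set_zigzag carrier by (rule subset_trans)
    show "length ?p = k * order G" by (simp add: length_zigzag len)
    show "?p ! 0 = \<one>\<^bsub>G\<^esub>"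
      using hd_zigzag[OF nonempty, of k] assms(4) start p_nonempty nonempty
      by (simp add: hd_conv_nth)
    fix x assume x: "x \<in> carrier G"
    show "count_list ?p x = k" using x by (simp add: count_zigzag count)
    show "count_list (consecutive_quotients G ?p) x = k"
      using count_consecutive_quotients_zigzag[OF carrier nonempty x, of k] x
      by (simp add: count_q)
  qed
  have "cyclic_D_sequence G ?p" if k: "k = 2"
  proof -
    have "?p ! (length ?p - 1) = \<one>\<^bsub>G\<^esub>"
      using last_zigzag[OF nonempty, of k] k start p_nonempty nonempty
      by (simp add: last_conv_nth hd_conv_nth)
    then show ?thesis
      using p k by (simp add: cyclic_D_sequence_def D_sequence_def length_zigzag len)
  qed
  with p show ?thesis by blast
qed

end
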